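(* Let $f:\mathbb{E}\to\mathbb{R}\cup\{+\infty\}$ be a proper extended real function and $\bar x\in\mathrm{dom}\,f$. Suppose that for every direction $u\in\mathbb{E}$, $u\ne0$, either $f^{(1)}_-(\bar x;u)>0$, or there exists a positive integer $n=n(u)\ge2$, which may depend on $u$, such that \[ 0\in\partial^{(1)}_- f(\bar x),\qquad 0\in\partial^{(i)}_- f(\bar x;\underbrace{0,\dots,0}_{(i-1)\text{ times}})\quad\text{for all integers } i \text{ with } 2\le i\le n-1, \] and \[ f^{(n)}_-(\bar x;\underbrace{0,0,\dots,0}_{(n-1)\text{ times}};u)>0 . \] Then $\bar x$ is a strict local minimizer of $f$.
   Context: $\mathbb{E}$ is a real finite-dimensional Euclidean space. $L^1(\mathbb{E})=L(\mathbb{E},\mathbb{R})$ is the space of continuous linear functionals, and $L^n(\mathbb{E})=L(\mathbb{E},L^{n-1}(\mathbb{E}))$ for $n>1$. A function $f:\mathbb{E}\to\mathbb{R}\cup\{+\infty\}$ is called a proper extended real function (it never takes the value $-\infty$), and $\mathrm{dom}\,f=\{x\in\mathbb{E}\mid f(x)<+\infty\}$. For $x\in\mathrm{dom}\,f$ and $u\in\mathbb{E}$, the lower Hadamard directional derivative is \[ f^{(1)}_-(x;u)=\liminf_{t\downarrow 0,\,u'\to u} t^{-1}[f(x+tu')-f(x)] \] (here $t\to0$ through positive values and $\|u'-u\|\to 0$), and the lower Hadamard subdifferential is $\partial^{(1)}_- f(x)=\{x^*\in L^1(\mathbb{E})\mid x^*(u)\le f^{(1)}_-(x;u)\ \forall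 u\in\mathbb{E}\}$. Recursively, for an integer $n\ge2$, given $x_1^*\in\partial^{(1)}_- f(x)$ and $x_i^*\in\partial^{(i)}_- f(x;x_1^*,\dots,x_{i-1}^* )$ for $i=2,\dots,n-1$, the lower derivative of Hadamard type of order $n$ is the element of $[-\infty,+\infty]$ \[ f^{(n)}_-(x;x_1^*,\dots,x_{n-1}^*;u)=\liminf_{t\downarrow0,\,u'\to u} n!\,t^{-n}\Big[f(x+tu')-f(x)-\sum_{i=1}^{n-1}\frac{t^i}{i!}\,x_i^*\underbrace{(u')\dots(u')}_{i\text{ times}}\Big], \] and the lower subdifferential of Hadamard type of order $n$ is \[ \partial^{(n)}_- f(x;x_1^*,\dots,x_{n-1}^* )=\{x^*\in L^n(\mathbb{E})\mid x^*\underbrace{(u)\dots(u)}_{n\text{ times}}\le f^{(n)}_-(x;x_1^*,\dots,x_{n-1}^*;u)\ \forall u\in\mathbb{E}\}. \] $\bar x$ is a strict local minimizer if $f(x)>f(\bar x)$ for all $x\ne\bar x$ in some neighborhood of $\bar x$. *)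

theory Defs
  imports "HOL-Analysis.Analysis"
begin

(* The spaces L^n(E) = L(E, L^(n-1)(E)) have a different type for every n, so they cannot be
   indexed by a number inside one type.  An element x of L^n(E) is encoded as the function on
   lists with x [u_1, ..., u_n] = x(u_1)...(u_n), set to 0 on lists of any other length so that
   the encoding is unique.  The recursion starts at L^0(E), the real numbers, and the curried map
   u |-> x(u) is (lambda us. x (u # us)).  Linearity and continuity of that map are required
   pointwise in us; as E is finite-dimensional, this is the same as continuity for the
   operator norm. *)
type_synonym 'a curried_form = "'a list \<Rightarrow> real"

primrec Lspace :: "nat \<Rightarrow> 'a::real_normed_vector curried_form set" where
  "Lspace 0 = {\<phi>. \<forall>us. us \<noteq> [] \<longrightarrow> \<phi> us = 0}"
| "Lspace (Suc n) = {\<phi>. \<phi> [] = 0 \<and> (\<forall>u. (\<lambda>us. \<phi> (u # us)) \<in> Lspace n)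
      \<and> (\<forall>us. bounded_linear (\<lambda>u. \<phi> (u # us)))}"

abbreviation zero_form :: "'a curried_form" where
  "zero_form \<equiv> (\<lambda>us. 0)"

definition effective_domain :: "('a \<Rightarrow> ereal) \<Rightarrow> 'a set" where
  "effective_domain f = {x. f x < \<infinity>}"

(* The order-n derivative at x, given xs = [x_1, ..., x_(n-1)].  It is meant for n >= 1,
   length xs = n - 1, x in the effective domain, and each x_i in the subdifferential of order i
   at x given x_1, ..., x_(i-1).  For n = 1 the sum is empty, which gives the lower Hadamard
   directional derivative.  The filter nhds u (rather than at u) is deliberate: u' may equal u. *)
definition lower_hadamard_deriv ::
  "nat \<Rightarrow> ('a::real_normed_vector \<Rightarrow> ereal) \<Rightarrow> 'a \<Rightarrow> 'a curried_form list \<Rightarrow> 'a \<Rightarrow> ereal" where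
  "lower_hadamard_deriv n f x xs u =
     Liminf (at_right (0::real) \<times>\<^sub>F nhds u)
       (\<lambda>(t, u'). ereal (fact n / t ^ n) *
          (f (x + t *\<^sub>R u') - f x
             - ereal (\<Sum>i = 1..n - 1. t ^ i / fact i * (xs ! (i - 1)) (replicate i u'))))"

definition lower_hadamard_subdiff ::
  "nat \<Rightarrow> ('a::real_normed_vector \<Rightarrow> ereal) \<Rightarrow> 'a \<Rightarrow> 'a curried_form list \<Rightarrow> 'a curried_form set" where
  "lower_hadamard_subdiff n f x xs =
     {\<phi> \<in> Lspace n. \<forall>u. ereal (\<phi> (replicate n u)) \<le> lower_hadamard_deriv n f x xs u}"

definition strict_local_minimizer :: "('a::topological_space \<Rightarrow> ereal) \<Rightarrow> 'a \<Rightarrow> bool" where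
  "strict_local_minimizer f x \<longleftrightarrow>
     (\<exists>U. open U \<and> x \<in> U \<and> (\<forall>y\<in>U. y \<noteq> x \<longrightarrow> f y > f x))"

lemma lower_hadamard_deriv_1:
  "lower_hadamard_deriv 1 f x [] u =
     Liminf (at_right (0::real) \<times>\<^sub>F nhds u) (\<lambda>(t, u'). ereal (inverse t) * (f (x + t *\<^sub>R u') - f x))"
  by (simp add: lower_hadamard_deriv_def inverse_eq_divide flip: zero_ereal_def)

lemma lower_hadamard_subdiff_1:
  "\<phi> \<in> lower_hadamard_subdiff 1 f x [] \<longleftrightarrow>
     \<phi> \<in> Lspace 1 \<and> (\<forall>u. ereal (\<phi> [u]) \<le> lower_hadamard_deriv 1 f x [] u)"
  by (simp add: lower_hadamard_subdiff_def)

lemma Lspace_1: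
  "\<phi> \<in> Lspace 1 \<longleftrightarrow>
     bounded_linear (\<lambda>u. \<phi> [u]) \<and> (\<forall>us. length us \<noteq> 1 \<longrightarrow> \<phi> us = 0)"
proof
  assume "\<phi> \<in> Lspace 1"
  then have *: "\<phi> [] = 0" "\<And>u us. us \<noteq> [] \<Longrightarrow> \<phi> (u # us) = 0"
    "\<And>us. bounded_linear (\<lambda>u. \<phi> (u # us))"
    by auto
  have "\<phi> us = 0" if "length us \<noteq> 1" for us
    using that * by (cases us) auto
  with * show "bounded_linear (\<lambda>u. \<phi> [u]) \<and> (\<forall>us. length us \<noteq> 1 \<longrightarrow> \<phi> us = 0)"
    by blast
next
  assume *: "bounded_linear (\<lambda>u. \<phi> [u]) \<and> (\<forall>us. length us \<noteq> 1 \<longrightarrow> \<phi> us = 0)"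
  have "bounded_linear (\<lambda>u. \<phi> (u # us))" for us
    using * by (cases us) auto
  with * show "\<phi> \<in> Lspace 1"
    by simp
qed

lemma zero_form_in_Lspace: "zero_form \<in> Lspace n"
  by (induction n) auto

end

theory Submission
  imports Defs
begin

text \<open>
  If the lower-order forms are zero, positivity of the derivative of any order in a direction \<open>u\<close>
  forces \<open>f (x + t *\<^sub>R u') > f x\<close> for all small \<open>t > 0\<close> and all \<open>u'\<close> near \<open>u\<close>: the sum
  vanishes and the factor in front of the difference is positive. The order only decides how
  fast \<open>f\<close> has to grow, so it may vary with the direction. Since \<open>u'\<close> ranges over a whole
  neighbourhood, compactness of the unit sphere turns the bounds on \<open>t\<close>, one for each direction,
  into a common radius \<open>d\<close>. Polar coordinates around \<open>x\<close> then cover the punctured ball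
  of radius \<open>d\<close>.
\<close>

text \<open>
  Finiteness of \<open>f x\<close> is essential: the extended difference is \<open>\<infinity>\<close> if both values are \<open>-\<infinity>\<close>
  or both are \<open>\<infinity>\<close>.
\<close>

lemma eventually_greater_if_lower_hadamard_deriv_pos:
  assumes finite: "\<bar>f x\<bar> \<noteq> \<infinity>"
    and pos: "lower_hadamard_deriv n f x (replicate (n - 1) zero_form) u > 0"
  shows "\<forall>\<^sub>F (t, u') in at_right (0::real) \<times>\<^sub>F nhds u. f (x + t *\<^sub>R u') > f x"
proof -
  have quotient_pos: "\<forall>\<^sub>F (t, u') in at_right (0::real) \<times>\<^sub>F nhds u.
      0 < ereal (fact n / t ^ n) * (f (x + t *\<^sub>R u') - f x - ereal (\<Sum>i = 1..n - 1.
        t ^ i / fact i * (replicate (n - 1) zero_form ! (i - 1)) (replicate i u')))"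
    using less_LiminfD[OF pos[unfolded lower_hadamard_deriv_def]]
    by (simp add: case_prod_unfold)
  have t_pos: "\<forall>\<^sub>F (t, u') in at_right (0::real) \<times>\<^sub>F nhds u. 0 < t"
    using eventually_prod1[THEN iffD2, OF _ eventually_at_right_less[of "0::real"], of "nhds u"]
    by (simp add: case_prod_unfold)
  show ?thesis
    using quotient_pos t_pos
  proof eventually_elim
    case (elim p)
    obtain t u' where p: "p = (t, u')"
      by fastforce
    have "(\<Sum>i = 1..n - 1. t ^ i / fact i *
        (replicate (n - 1) zero_form ! (i - 1)) (replicate i u')) = 0"
      by (rule sum.neutral) auto
    then have "0 < ereal (fact n / t ^ n) * (f (x + t *\<^sub>R u') - f x)" and "0 < t"
      using elim by (simp_all add: p flip: zero_ereal_def)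
    then have "0 < f (x + t *\<^sub>R u') - f x"
      by (auto simp: ereal_zero_less_0_iff divide_less_0_iff)
    then show ?case
      using finite by (simp add: p ereal_less_minus_iff)
  qed
qed

text \<open>The tube lemma for a filter in place of the neighbourhoods of a point.\<close>

lemma eventually_ball_compact:
  assumes "compact S"
    and local: "\<And>u. u \<in> S \<Longrightarrow> \<forall>\<^sub>F (t, u') in F \<times>\<^sub>F nhds u. P t u'"
  shows "\<forall>\<^sub>F t in F. \<forall>u\<in>S. P t u"
proof -
  have "\<exists>V Q. open V \<and> u \<in> V \<and> eventually Q F \<and> (\<forall>t. Q t \<longrightarrow> (\<forall>u'\<in>V. P t u'))"
    if "u \<in> S" for u
    using local[OF that] unfolding eventually_prod_filter eventually_nhds
    by (simp; metis)
  then obtain V Q where open_V: "\<And>u. u \<in> S \<Longrightarrow> open (V u)" and V: "\<And>u. u \<in> S \<Longrightarrow> u \<in> V u"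
    and Q: "\<And>u. u \<in> S \<Longrightarrow> eventually (Q u) F"
    and P: "\<And>u t u'. u \<in> S \<Longrightarrow> Q u t \<Longrightarrow> u' \<in> V u \<Longrightarrow> P t u'"
    by metis
  obtain C where C: "C \<subseteq> S" "finite C" "S \<subseteq> (\<Union>u\<in>C. V u)"
    using compactE_image[OF \<open>compact S\<close>, of S V] open_V V by blast
  have "\<forall>\<^sub>F t in F. \<forall>u\<in>C. Q u t"
    using C Q by (intro eventually_ball_finite) auto
  then show ?thesis
    by eventually_elim (use C P in blast)
qed

lemma strict_local_minimizer_if_greater_along_sphere:
  fixes f :: "'a::euclidean_space \<Rightarrow> ereal"
  assumes "\<And>u. u \<in> sphere 0 1 \<Longrightarrow>
      \<forall>\<^sub>F (t, u') in at_right (0::real) \<times>\<^sub>F nhds u. f (x + t *\<^sub>R u') > f x"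
  shows "strict_local_minimizer f x"
proof -
  have "\<forall>\<^sub>F t in at_right (0::real). \<forall>u\<in>sphere 0 1. f (x + t *\<^sub>R u) > f x"
    using assms by (intro eventually_ball_compact compact_sphere)
  then obtain d :: real where "d > 0"
    and d: "\<And>t u. 0 < t \<Longrightarrow> t < d \<Longrightarrow> u \<in> sphere 0 1 \<Longrightarrow> f (x + t *\<^sub>R u) > f x"
    by (auto simp: eventually_at_right_field)
  have "f y > f x" if "y \<in> ball x d" "y \<noteq> x" for y
  proof -
    have "f (x + norm (y - x) *\<^sub>R sgn (y - x)) > f x"
      using that by (intro d) (auto simp: dist_norm norm_minus_commute norm_sgn)
    then show ?thesis
      using that by (simp add: sgn_div_norm)
  qed
  then show ?thesis
    unfolding strict_local_minimizer_def
    using \<open>d > 0\<close> by (intro exI[of _ "ball x d"]) auto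
qed

theorem theorem3p5:
  fixes f :: "'a::euclidean_space \<Rightarrow> ereal" and xbar :: 'a
  assumes proper: "\<And>x. f x \<noteq> - \<infinity>"
    and dom: "xbar \<in> effective_domain f"
    and directions: "\<And>u. u \<noteq> 0 \<Longrightarrow>
      lower_hadamard_deriv 1 f xbar [] u > 0 \<or>
      (\<exists>n\<ge>2.
         zero_form \<in> lower_hadamard_subdiff 1 f xbar [] \<and>
         (\<forall>i. 2 \<le> i \<and> i \<le> n - 1 \<longrightarrow>
            zero_form \<in> lower_hadamard_subdiff i f xbar (replicate (i - 1) zero_form)) \<and>
         lower_hadamard_deriv n f xbar (replicate (n - 1) zero_form) u > 0)"
  shows "strict_local_minimizer f xbar"
proof (rule strict_local_minimizer_if_greater_along_sphere)
  fix u :: 'a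
  assume "u \<in> sphere 0 1"
  then have "u \<noteq> 0"
    by auto
  have finite: "\<bar>f xbar\<bar> \<noteq> \<infinity>"
    using proper[of xbar] dom by (auto simp: effective_domain_def)
  obtain n where "lower_hadamard_deriv n f xbar (replicate (n - 1) zero_form) u > 0"
  proof (cases "lower_hadamard_deriv 1 f xbar [] u > 0")
    case True
    then show ?thesis
      by (intro that[of 1]) simp
  next
    case False
    then show ?thesis
      using directions[OF \<open>u \<noteq> 0\<close>] that by blast
  qed
  then show "\<forall>\<^sub>F (t, u') in at_right (0::real) \<times>\<^sub>F nhds u. f (xbar + t *\<^sub>R u') > f xbar"
    by (intro eventually_greater_if_lower_hadamard_deriv_pos finite)
qed

end
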